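(* Let $D$ be a drawing of a graph $H$ with $s$ distinct edge slopes and $\ell$ distinct edge lengths, and let $t:=|\{(\mathrm{slope}(e),\mathrm{length}(e)) : e\in E(H)\}|$ be the number of distinct slope–length pairs of edges in $D$ (so $t\leq s\ell$). Let $G$ be a graph that has an $H$-partition of width $k$. Then $G$ has a drawing with at most $k+s+t(k^2-k)\leq k+s+s\ell(k^2-k)$ distinct edge slopes and at most $\lfloor k/2\rfloor+\ell+t(k^2-k)\leq\lfloor k/2\rfloor+\ell+s\ell(k^2-k)$ distinct edge lengths.
   Context: A (straight-line) drawing of a graph maps its vertices to distinct points in the plane and represents each edge by the closed line segment between its endpoints, such that each edge segment intersects no vertex other than its own endpoints. The slope of an edge is the angle in $[0,\pi)$ from the $x$-axis to the line containing it, and its length is the Euclidean length of the segment. For a graph $H$, an $H$-partition of a graph $G$ is a function $f:V(G)\to V(H)$ such that for every edge $vw\in E(G)$, either $f(v)=f(w)$ or $f(v)f(w)\in E(H)$. Its width is $\max_{x\in V(H)}|f^{-1}(x)|$. *)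

theory Defs
  imports "HOL-Analysis.Analysis" "Graph_Theory.Pair_Digraph"
begin

text \<open>
  Finite simple undirected graphs are \<^locale>\<open>pair_graph\<close>s: an edge \<open>uv\<close> is the pair of arcs
  \<open>(u, v)\<close> and \<open>(v, u)\<close>. The plane is the type \<^typ>\<open>complex\<close>.
\<close>

definition is_drawing :: "'a pair_pre_digraph \<Rightarrow> ('a \<Rightarrow> complex) \<Rightarrow> bool" where
  "is_drawing G D \<longleftrightarrow>
     inj_on D (pverts G) \<and>
     (\<forall>(u, v) \<in> parcs G. \<forall>w \<in> pverts G.
        D w \<in> closed_segment (D u) (D v) \<longrightarrow> w = u \<or> w = v)"

text \<open>Only meaningful for \<open>p \<noteq> q\<close>, see \<open>slope_ex1\<close> below.\<close>

definition slope :: "complex \<Rightarrow> complex \<Rightarrow> real" where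
  "slope p q = (THE \<theta>. 0 \<le> \<theta> \<and> \<theta> < pi \<and>
     affine hull {p, q} = range (\<lambda>r::real. p + of_real r * cis \<theta>))"

text \<open>
  Both arcs of an edge have the same slope and the same length, so counting over arcs
  amounts to counting over edges.
\<close>

definition edge_slopes :: "'a pair_pre_digraph \<Rightarrow> ('a \<Rightarrow> complex) \<Rightarrow> real set" where
  "edge_slopes G D = {slope (D u) (D v) | u v. (u, v) \<in> parcs G}"

definition edge_lengths :: "'a pair_pre_digraph \<Rightarrow> ('a \<Rightarrow> complex) \<Rightarrow> real set" where
  "edge_lengths G D = {dist (D u) (D v) | u v. (u, v) \<in> parcs G}"

definition edge_slope_lengths :: "'a pair_pre_digraph \<Rightarrow> ('a \<Rightarrow> complex) \<Rightarrow> (real \<times> real) set" where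
  "edge_slope_lengths G D =
     {(slope (D u) (D v), dist (D u) (D v)) | u v. (u, v) \<in> parcs G}"

definition is_partition ::
    "'b pair_pre_digraph \<Rightarrow> 'a pair_pre_digraph \<Rightarrow> ('a \<Rightarrow> 'b) \<Rightarrow> bool" where
  "is_partition H G f \<longleftrightarrow>
     f \<in> pverts G \<rightarrow> pverts H \<and>
     (\<forall>(v, w) \<in> parcs G. f v = f w \<or> (f v, f w) \<in> parcs H)"

text \<open>
  For a finite set of naturals \<open>Sup\<close> is the maximum, and \<open>Sup {} = 0\<close>, so the width is \<open>0\<close> if
  \<open>H\<close> has no vertices.
\<close>

definition partition_width ::
    "'b pair_pre_digraph \<Rightarrow> 'a pair_pre_digraph \<Rightarrow> ('a \<Rightarrow> 'b) \<Rightarrow> nat" where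
  "partition_width H G f = (SUP x \<in> pverts H. card {v \<in> pverts G. f v = x})"

lemma affine_hull_pair_line:
  fixes p q :: complex
  assumes "q - p = of_real c * cis \<theta>" "c \<noteq> 0"
  shows "affine hull {p, q} = range (\<lambda>r::real. p + of_real r * cis \<theta>)"
proof -
  have "affine hull {p, q} = range (\<lambda>u::real. p + of_real u * (q - p))"
    by (simp add: affine_hull_2_alt scaleR_conv_of_real)
  also have "\<dots> = range (\<lambda>r::real. p + of_real r * cis \<theta>)"
  proof (intro equalityI subsetI)
    fix x assume "x \<in> range (\<lambda>u::real. p + of_real u * (q - p))"
    then obtain u :: real where "x = p + of_real u * (q - p)" by blast
    then have "x = p + of_real (u * c) * cis \<theta>" using assms(1) by simp
    then show "x \<in> range (\<lambda>r::real. p + of_real r * cis \<theta>)" by blast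
  next
    fix x assume "x \<in> range (\<lambda>r::real. p + of_real r * cis \<theta>)"
    then obtain r :: real where "x = p + of_real r * cis \<theta>" by blast
    then have "x = p + of_real (r / c) * (q - p)" using assms by simp
    then show "x \<in> range (\<lambda>u::real. p + of_real u * (q - p))" by blast
  qed
  finally show ?thesis .
qed

lemma slope_ex1:
  assumes "p \<noteq> q"
  shows "\<exists>!\<theta>. 0 \<le> \<theta> \<and> \<theta> < pi \<and>
           affine hull {p, q} = range (\<lambda>r::real. p + of_real r * cis \<theta>)"
proof (rule ex_ex1I)
  define n where "n = norm (q - p)"
  define a where "a = Arg (q - p)"
  have n: "n \<noteq> 0" using assms by (simp add: n_def)
  have a: "-pi < a" "a \<le> pi" using Arg_bounded by (auto simp: a_def)
  have qp: "q - p = of_real n * cis a"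
    unfolding n_def a_def using rcis_cmod_Arg[of "q - p"] by (simp add: rcis_def)
  consider "0 \<le> a \<and> a < pi" | "a < 0" | "a = pi" using a by linarith
  then show "\<exists>\<theta>. 0 \<le> \<theta> \<and> \<theta> < pi \<and>
               affine hull {p, q} = range (\<lambda>r::real. p + of_real r * cis \<theta>)"
  proof cases
    case 1
    then show ?thesis using affine_hull_pair_line[OF qp n] by blast
  next
    case 2
    have "q - p = of_real (- n) * cis (a + pi)" using qp by (simp flip: cis_mult)
    from affine_hull_pair_line[OF this] n a 2 show ?thesis
      by (intro exI[of _ "a + pi"]) auto
  next
    case 3
    have "q - p = of_real (- n) * cis 0" using qp 3 by simp
    from affine_hull_pair_line[OF this] n show ?thesis
      by (intro exI[of _ 0]) auto
  qed
next
  fix \<theta> \<phi>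
  assume A: "0 \<le> \<theta> \<and> \<theta> < pi \<and>
      affine hull {p, q} = range (\<lambda>r::real. p + of_real r * cis \<theta>)"
    and B: "0 \<le> \<phi> \<and> \<phi> < pi \<and>
      affine hull {p, q} = range (\<lambda>r::real. p + of_real r * cis \<phi>)"
  have "p + of_real 1 * cis \<theta> \<in> range (\<lambda>r::real. p + of_real r * cis \<phi>)"
    using A B by blast
  then obtain r :: real where "cis \<theta> = of_real r * cis \<phi>" by auto
  then have "cis (\<theta> - \<phi>) = of_real r" by (simp flip: cis_divide)
  then have "sin (\<theta> - \<phi>) = 0" by (metis Im_complex_of_real cis.simps(2))
  moreover have "\<bar>\<theta> - \<phi>\<bar> < pi" using A B by auto
  ultimately show "\<theta> = \<phi>" using sin_eq_0_pi[of "\<theta> - \<phi>"] by auto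
qed

lemma line_shift:
  fixes p q :: complex
  assumes "affine hull {p, q} = range (\<lambda>r::real. p + of_real r * cis \<theta>)"
  shows "affine hull {q, p} = range (\<lambda>r::real. q + of_real r * cis \<theta>)"
proof -
  have "q \<in> range (\<lambda>r::real. p + of_real r * cis \<theta>)"
    using assms hull_inc[of q "{p, q}" affine] by auto
  then obtain c :: real where q: "q = p + of_real c * cis \<theta>" by blast
  have "range (\<lambda>r::real. p + of_real r * cis \<theta>) = range (\<lambda>r::real. q + of_real r * cis \<theta>)"
  proof (intro equalityI image_subsetI)
    fix r :: real
    have "p + of_real r * cis \<theta> = q + of_real (r - c) * cis \<theta>"
      by (simp add: q algebra_simps)
    then show "p + of_real r * cis \<theta> \<in> range (\<lambda>r::real. q + of_real r * cis \<theta>)"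
      by (rule range_eqI)
  next
    fix r :: real
    have "q + of_real r * cis \<theta> = p + of_real (c + r) * cis \<theta>"
      by (simp add: q algebra_simps)
    then show "q + of_real r * cis \<theta> \<in> range (\<lambda>r::real. p + of_real r * cis \<theta>)"
      by (rule range_eqI)
  qed
  then show ?thesis using assms by (simp only: insert_commute)
qed

lemma slope_commute: "slope p q = slope q p"
proof -
  have "(affine hull {p, q} = range (\<lambda>r::real. p + of_real r * cis \<theta>)) =
      (affine hull {q, p} = range (\<lambda>r::real. q + of_real r * cis \<theta>))" for \<theta>
    using line_shift[of p q \<theta>] line_shift[of q p \<theta>] by blast
  then show ?thesis unfolding slope_def by (simp only:)
qed

end

theory Submission
  imports Defs
begin

text \<open>
  Place a tiny copy of the same regular \<open>k\<close>-gon at every vertex of \<open>H\<close> and put the vertices of a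
  part on distinct corners of its polygon. Edges inside a part are chords of the polygon, which have
  only \<open>k\<close> directions and \<open>k div 2\<close> lengths. An edge between parts is a translate of an edge of
  \<open>H\<close> if its two corners correspond; otherwise it is determined, up to sign and translation, by the
  slope and length of the edge of \<open>H\<close> and by an ordered pair of distinct corners. If no chord of the
  polygon is parallel to an edge of \<open>H\<close>, which holds for a generic rotation, then all sufficiently
  small scalings give a drawing.
\<close>

section \<open>Slopes and signed polar form\<close>

lemma slope_eqI:
  assumes "q - p = of_real c * cis \<theta>" "c \<noteq> 0" "0 \<le> \<theta>" "\<theta> < pi"
  shows "slope p q = \<theta>"
proof -
  have "p \<noteq> q" using assms(1,2) by auto
  from slope_ex1[OF this] show ?thesis
    unfolding slope_def using affine_hull_pair_line[OF assms(1,2)] assms(3,4)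
    by (intro the1_equality) auto
qed

text \<open>The factor \<open>c\<close> is signed because a slope in [0, pi) forgets the order of
  \<open>p\<close> and \<open>q\<close>; this sign later decides how an edge is oriented.\<close>

lemma slope_polar:
  assumes "p \<noteq> q"
  obtains c :: real where "q - p = of_real c * cis (slope p q)" "\<bar>c\<bar> = dist p q"
    "0 \<le> slope p q" "slope p q < pi"
proof -
  have S: "0 \<le> slope p q \<and> slope p q < pi \<and>
      affine hull {p, q} = range (\<lambda>r::real. p + of_real r * cis (slope p q))"
    unfolding slope_def by (rule theI') (rule slope_ex1[OF assms])
  moreover have "q \<in> affine hull {p, q}" by (simp add: hull_inc)
  ultimately obtain c :: real where c: "q = p + of_real c * cis (slope p q)" by auto
  have "\<bar>c\<bar> = norm (of_real c * cis (slope p q))" by (simp add: norm_mult)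
  also have "of_real c * cis (slope p q) = q - p" using c by (simp add: algebra_simps)
  also have "norm (q - p) = dist p q" by (simp add: dist_norm norm_minus_commute)
  finally show ?thesis using that[of c] c S by (metis add_diff_cancel_left')
qed

text \<open>A real multiple spans the same line. Negative \<open>c\<close> is allowed, so reversed
  edges are covered too.\<close>

lemma slope_scale:
  assumes "q' - p' = of_real c * (q - p)" "c \<noteq> 0" "p \<noteq> q"
  shows "slope p' q' = slope p q"
proof -
  obtain d :: real where d: "q - p = of_real d * cis (slope p q)" "\<bar>d\<bar> = dist p q"
    "0 \<le> slope p q" "slope p q < pi" using slope_polar[OF assms(3)] .
  show ?thesis
  proof (rule slope_eqI)
    show "q' - p' = of_real (c * d) * cis (slope p q)" using assms(1) d(1) by simp
    show "c * d \<noteq> 0" using assms(2,3) d(2) by auto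
  qed (use d in auto)
qed

section \<open>Small perturbations and generic rotation\<close>

text \<open>Missing a compact segment is an open condition: a ball of radius \<open>d\<close> around
  \<open>p\<close> avoids it, and the perturbation moves \<open>p\<close> relative to any point of
  the segment by at most \<open>e\<close> times the sum of the three norms.\<close>

lemma eventually_notin_closed_segment:
  fixes p a b p' a' b' :: "'a::euclidean_space"
  assumes "p \<notin> closed_segment a b"
  shows "\<forall>\<^sub>F e in at_right 0. p + e *\<^sub>R p' \<notin> closed_segment (a + e *\<^sub>R a') (b + e *\<^sub>R b')"
proof -
  have "open (- closed_segment a b)" by (simp add: open_Compl)
  then obtain d where d: "d > 0" "ball p d \<subseteq> - closed_segment a b"
    using assms by (metis Compl_iff openE)
  have "((\<lambda>e. e * (norm p' + norm a' + norm b')) \<longlongrightarrow> 0 * (norm p' + norm a' + norm b')) (at_right 0)"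
    by (intro tendsto_intros)
  then have "\<forall>\<^sub>F e in at_right 0. e * (norm p' + norm a' + norm b') < d"
    using d(1) by (auto dest: order_tendstoD(2))
  moreover have "\<forall>\<^sub>F e in at_right (0::real). e > 0" by (rule eventually_at_right_less)
  ultimately show ?thesis
  proof eventually_elim
    case (elim e)
    show ?case
    proof
      assume "p + e *\<^sub>R p' \<in> closed_segment (a + e *\<^sub>R a') (b + e *\<^sub>R b')"
      then obtain u where u: "0 \<le> u" "u \<le> 1"
        and eq: "p + e *\<^sub>R p' = (1 - u) *\<^sub>R (a + e *\<^sub>R a') + u *\<^sub>R (b + e *\<^sub>R b')"
        by (auto simp: in_segment)
      \<comment> \<open>The point of the unperturbed segment with the same parameter
        \<open>u\<close>.\<close>
      define q where "q = (1 - u) *\<^sub>R a + u *\<^sub>R b"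
      have q: "q \<in> closed_segment a b" using u by (auto simp: q_def in_segment)
      have "p - q = e *\<^sub>R (((1 - u) *\<^sub>R a' + u *\<^sub>R b') - p')"
        using eq by (simp add: q_def algebra_simps)
      then have "dist p q = e * norm (((1 - u) *\<^sub>R a' + u *\<^sub>R b') - p')"
        using elim(2) by (simp add: dist_norm)
      also have "norm (((1 - u) *\<^sub>R a' + u *\<^sub>R b') - p') \<le> norm ((1 - u) *\<^sub>R a') + norm (u *\<^sub>R b') + norm p'"
        by (intro order_trans[OF norm_triangle_ineq4] add_right_mono norm_triangle_ineq)
      also have "\<dots> \<le> norm p' + norm a' + norm b'"
        using u mult_left_le_one_le[of "norm a'" "1 - u"] mult_left_le_one_le[of "norm b'" u] by simp
      finally have "dist p q < d" using elim by (simp add: mult_left_mono)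
      then show False using d(2) q by auto
    qed
  qed
qed

text \<open>Here the limit point is the end \<open>a\<close> of the limit segment, so openness gives
  nothing and directions decide. \<open>Im (x * cnj y)\<close> is a cross product up to sign: the
  offset \<open>p' - a'\<close> is not parallel to \<open>b - a\<close>, hence not to the nearby
  direction of the perturbed segment.\<close>

lemma eventually_notin_closed_segment_endpoint:
  fixes a b p' a' b' :: complex
  assumes "Im ((p' - a') * cnj (b - a)) \<noteq> 0"
  shows "\<forall>\<^sub>F e in at_right 0. a + e *\<^sub>R p' \<notin> closed_segment (a + e *\<^sub>R a') (b + e *\<^sub>R b')"
proof -
  define F where "F = (\<lambda>e::real. (p' - a') * cnj ((b - a) + e *\<^sub>R (b' - a')))"
  have "((\<lambda>e. Im (F e)) \<longlongrightarrow> Im ((p' - a') * cnj ((b - a) + 0 *\<^sub>R (b' - a')))) (at_right 0)"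
    unfolding F_def by (intro tendsto_intros)
  then have "\<forall>\<^sub>F e in at_right 0. Im (F e) \<noteq> 0"
    using assms by (intro tendsto_imp_eventually_ne) auto
  moreover have "\<forall>\<^sub>F e in at_right (0::real). e > 0" by (rule eventually_at_right_less)
  ultimately show ?thesis
  proof eventually_elim
    case (elim e)
    show ?case
    proof
      assume "a + e *\<^sub>R p' \<in> closed_segment (a + e *\<^sub>R a') (b + e *\<^sub>R b')"
      then obtain u where
        eq: "a + e *\<^sub>R p' = (1 - u) *\<^sub>R (a + e *\<^sub>R a') + u *\<^sub>R (b + e *\<^sub>R b')"
        by (auto simp: in_segment)
      define z where "z = (b - a) + e *\<^sub>R (b' - a')"
      have "e *\<^sub>R (p' - a') = u *\<^sub>R z" using eq by (simp add: z_def algebra_simps)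
      \<comment> \<open>Multiplying by \<open>cnj z\<close> makes the right-hand side real, so
        taking imaginary parts removes the unknown \<open>u\<close>.\<close>
      then have "e *\<^sub>R F e = u *\<^sub>R (z * cnj z)"
        unfolding F_def z_def[symmetric] by (metis mult_scaleR_left)
      then have "e * Im (F e) = u * Im (z * cnj z)" by (metis scaleR_complex.simps(2))
      then show False using elim by simp
    qed
  qed
qed

text \<open>For \<open>u = Complex 1 r\<close> the imaginary part of \<open>u * a\<close> is
  \<open>Im a + r * Re a\<close>. If \<open>Re a\<close> is nonzero, it vanishes for a single
  \<open>r\<close>; otherwise it is the nonzero number \<open>Im a\<close>. So finitely many
  \<open>r\<close> are excluded.\<close>

lemma exists_generic_rotation:
  assumes "finite A" "0 \<notin> A"
  obtains u :: complex where "u \<noteq> 0" "\<And>a. a \<in> A \<Longrightarrow> Im (u * a) \<noteq> 0"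
proof -
  obtain r :: real where r: "r \<notin> (\<lambda>a. - Im a / Re a) ` A"
    using ex_new_if_finite[OF infinite_UNIV_char_0 finite_imageI[OF assms(1)]] by blast
  show thesis
  proof (rule that)
    show "Complex 1 r \<noteq> 0" by (simp add: complex_eq_iff)
    fix a assume a: "a \<in> A"
    then have "a \<noteq> 0" "r \<noteq> - Im a / Re a" using assms(2) r by auto
    then show "Im (Complex 1 r * a) \<noteq> 0"
      by (cases "Re a = 0") (auto simp: complex_eq_iff field_simps)
  qed
qed

section \<open>Circles and regular polygons\<close>

text \<open>Strict convexity of the ball: a point inside the segment is closer to the centre than
  one of the ends. This keeps polygon corners off the chords between other corners.\<close>

lemma closed_segment_circle_endpoint:
  fixes a b p :: "'a::euclidean_space"
  assumes "p \<in> closed_segment a b" "norm p = r" "norm a = r" "norm b = r"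
  shows "p = a \<or> p = b"
proof (rule ccontr)
  assume "\<not> (p = a \<or> p = b)"
  then have "p \<in> open_segment a b" using assms(1) by (simp add: open_segment_def)
  from dist_decreases_open_segment[OF this, of 0] show False using assms by simp
qed

text \<open>The powers of a primitive \<open>k\<close>-th root of unity. For \<open>k = 0\<close>
  the quotient is 0 and every corner is 1, so the norm is 1 for all \<open>k\<close>.\<close>

definition polygon_corner :: "nat \<Rightarrow> nat \<Rightarrow> complex" where
  "polygon_corner k i = cis (2 * pi * real i / real k)"

lemma norm_polygon_corner [simp]: "norm (polygon_corner k i) = 1"
  by (simp add: polygon_corner_def)

text \<open>With mean angle \<open>x\<close> and half difference \<open>y\<close>,
  \<open>cis (x + y) - cis (x - y)\<close> is \<open>2 * sin y\<close> times
  \<open>\<i> * cis x\<close>. Thus the direction of a chord depends only on \<open>i + j\<close>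
  and its length only on \<open>j - i\<close>, which is the source of both counts for edges inside a
  part.\<close>

lemma polygon_corner_diff:
  "polygon_corner k j - polygon_corner k i =
     of_real (2 * sin (pi * (real j - real i) / real k)) * (\<i> * cis (pi * real (i + j) / real k))"
proof -
  define x y where "x = pi * real (i + j) / real k" and "y = pi * (real j - real i) / real k"
  have "2 * pi * real j / real k = x + y" "2 * pi * real i / real k = x - y"
    by (auto simp: x_def y_def field_simps add_divide_distrib diff_divide_distrib)
  then show ?thesis
    unfolding polygon_corner_def x_def[symmetric] y_def[symmetric]
    by (simp only:) (simp add: complex_eq_iff cos_add sin_add cos_diff sin_diff algebra_simps)
qed

lemma inj_on_polygon_corner: "inj_on (polygon_corner k) {..<k}"
proof (rule inj_onI, rule ccontr)
  have *: "sin (pi * (real j - real i) / real k) \<noteq> 0" if "i < j" "j < k" for i j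
  proof -
    have "0 < (real j - real i) / real k" "(real j - real i) / real k < 1"
      using that by auto
    then have "0 < sin (pi * ((real j - real i) / real k))"
      using mult_strict_left_mono[of "(real j - real i) / real k" 1 pi]
      by (intro sin_gt_zero mult_pos_pos pi_gt_zero) simp_all
    then show ?thesis by simp
  qed
  have **: "polygon_corner k j \<noteq> polygon_corner k i" if "i < j" "j < k" for i j
    using polygon_corner_diff[of k j i] *[OF that] by auto
  fix i j assume "i \<in> {..<k}" "j \<in> {..<k}" "polygon_corner k i = polygon_corner k j" "i \<noteq> j"
  then show False using **[of i j] **[of j i] by (cases i j rule: linorder_cases) auto
qed

text \<open>Adding \<open>k\<close> to \<open>i + j\<close> turns the direction by pi and keeps the
  line, so the residue of \<open>i + j\<close> modulo \<open>k\<close> determines the slope. The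
  factor \<open>w\<close> allows for rotating and scaling the polygon.\<close>

lemma polygon_corner_slope:
  assumes "i < k" "j < k" "w \<noteq> 0" "q - p = w * (polygon_corner k j - polygon_corner k i)" "p \<noteq> q"
  shows "slope p q = slope 0 (w * (\<i> * cis (pi * real ((i + j) mod k) / real k)))"
proof -
  define m where "m = (i + j) mod k"
  define \<sigma> where "\<sigma> = 2 * sin (pi * (real j - real i) / real k)"
  have qp: "q - p = of_real \<sigma> * (w * (\<i> * cis (pi * real (i + j) / real k)))"
    using assms(4) unfolding polygon_corner_diff \<sigma>_def by (simp add: mult_ac)
  have "\<sigma> \<noteq> 0" using assms(5) qp by auto
  \<comment> \<open>Both indices are below \<open>k\<close>, so reduction subtracts \<open>k\<close>
    at most once.\<close>
  have "i + j = m \<or> i + j = m + k"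
    using assms(1,2) by (cases "i + j < k") (auto simp: m_def le_mod_geq)
  then have "cis (pi * real (i + j) / real k) = cis (pi * real m / real k) \<or>
      cis (pi * real (i + j) / real k) = - cis (pi * real m / real k)"
  proof
    assume "i + j = m + k"
    then have "pi * real (i + j) / real k = pi * real m / real k + pi"
      using assms(1) by (simp add: field_simps)
    then show ?thesis by (simp flip: cis_mult)
  qed simp
  then obtain c where "c \<noteq> 0" "q - p = of_real c * (w * (\<i> * cis (pi * real m / real k)) - 0)"
  proof
    assume "cis (pi * real (i + j) / real k) = cis (pi * real m / real k)"
    then show ?thesis using that[of \<sigma>] qp \<open>\<sigma> \<noteq> 0\<close> by simp
  next
    assume "cis (pi * real (i + j) / real k) = - cis (pi * real m / real k)"
    then show ?thesis using that[of "- \<sigma>"] qp \<open>\<sigma> \<noteq> 0\<close> by simp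
  qed
  then show ?thesis unfolding m_def[symmetric] using assms(3) by (intro slope_scale) auto
qed

text \<open>The length depends only on the index distance \<open>d\<close>, and
  \<open>sin (pi - x) = sin x\<close> identifies \<open>d\<close> with \<open>k - d\<close>; one of
  these is at most \<open>k div 2\<close>.\<close>

lemma polygon_corner_dist:
  assumes "i < k" "j < k" "i \<noteq> j"
  shows "norm (polygon_corner k j - polygon_corner k i)
           \<in> (\<lambda>d. 2 * \<bar>sin (pi * real d / real k)\<bar>) ` {1..k div 2}"
proof -
  define d where "d = (if i < j then j - i else i - j)"
  have d: "1 \<le> d" "d < k" using assms by (auto simp: d_def)
  have "norm (polygon_corner k j - polygon_corner k i) = 2 * \<bar>sin (pi * (real j - real i) / real k)\<bar>"
    unfolding polygon_corner_diff by (simp add: norm_mult abs_mult)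
  also have "\<bar>sin (pi * (real j - real i) / real k)\<bar> = \<bar>sin (pi * real d / real k)\<bar>"
  proof (cases "i < j")
    case False
    then have "real j - real i = - real d" by (simp add: d_def of_nat_diff)
    then have "pi * (real j - real i) / real k = - (pi * real d / real k)" by simp
    then show ?thesis by simp
  qed (simp add: d_def of_nat_diff)
  finally have *: "norm (polygon_corner k j - polygon_corner k i) = 2 * \<bar>sin (pi * real d / real k)\<bar>" .
  show ?thesis
  proof (cases "d \<le> k div 2")
    case False
    have "pi * real (k - d) / real k = pi - pi * real d / real k"
      using d by (simp add: of_nat_diff field_simps)
    then have "sin (pi * real (k - d) / real k) = sin (pi * real d / real k)" by simp
    then show ?thesis using * d False by (intro image_eqI[of _ _ "k - d"]) auto
  qed (use * d in auto)
qed

section \<open>Pairs of corners and the numbering of the parts\<close>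

lemma card_off_diagonal: "card {(i, j). i < k \<and> j < k \<and> i \<noteq> j} = k\<^sup>2 - k"
proof -
  have "{(i, j). i < k \<and> j < k \<and> i \<noteq> j} = {..<k} \<times> {..<k} - (\<lambda>i. (i, i)) ` {..<k}" by auto
  moreover have "card \<dots> = k * k - k"
    by (subst card_Diff_subset) (auto simp: card_image inj_on_def)
  ultimately show ?thesis by (simp add: power2_eq_square)
qed

text \<open>Each part has at most \<open>k\<close> vertices and so injects into
  \<open>{..<k}\<close>; gluing these injections gives \<open>g\<close>, the corner number of a
  vertex.\<close>

lemma partition_index:
  assumes "finite (pverts H)" "finite (pverts G)" "f \<in> pverts G \<rightarrow> pverts H"
    "partition_width H G f = k"
  obtains g where "\<And>v. v \<in> pverts G \<Longrightarrow> g v < k"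
    "\<And>v w. v \<in> pverts G \<Longrightarrow> w \<in> pverts G \<Longrightarrow> f v = f w \<Longrightarrow> g v = g w \<Longrightarrow> v = w"
proof -
  have "\<exists>h. h ` {v \<in> pverts G. f v = x} \<subseteq> {..<k} \<and> inj_on h {v \<in> pverts G. f v = x}"
    if "x \<in> pverts H" for x
  proof -
    have "card {v \<in> pverts G. f v = x} \<le> k"
      unfolding assms(4)[symmetric] partition_width_def
      using that assms(1) by (intro cSUP_upper bdd_above_finite) auto
    then show ?thesis using card_le_inj[of "{v \<in> pverts G. f v = x}" "{..<k}"] assms(2) by auto
  qed
  then obtain h where h: "\<And>x. x \<in> pverts H \<Longrightarrow>
      h x ` {v \<in> pverts G. f v = x} \<subseteq> {..<k} \<and> inj_on (h x) {v \<in> pverts G. f v = x}"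
    by metis
  show thesis
  proof (rule that[of "\<lambda>v. h (f v) v"])
    fix v assume v: "v \<in> pverts G"
    then show "h (f v) v < k" using h[of "f v"] assms(3) by blast
    fix w assume "w \<in> pverts G" "f v = f w" "h (f v) v = h (f w) w"
    then show "v = w" using v h[of "f v"] assms(3) by (auto simp: inj_on_def)
  qed
qed

section \<open>Existence of the drawing\<close>

text \<open>Of the corners only distinctness and norm 1 matter. A generic \<open>u\<close> is fixed
  first; then each of finitely many forbidden incidences is absent for all small scales
  \<open>e > 0\<close>, and \<open>w\<close> is \<open>e\<close> times \<open>u\<close>.\<close>

lemma exists_blow_up_drawing:
  fixes c :: "nat \<Rightarrow> complex"
  assumes "pair_graph H" "pair_graph G" "is_drawing H D" "is_partition H G f"
    and g: "\<And>v. v \<in> pverts G \<Longrightarrow> g v < k"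
      "\<And>v w. v \<in> pverts G \<Longrightarrow> w \<in> pverts G \<Longrightarrow> f v = f w \<Longrightarrow> g v = g w \<Longrightarrow> v = w"
    and c: "inj_on c {..<k}" "\<And>i. norm (c i) = 1"
  obtains w :: complex where "w \<noteq> 0" "is_drawing G (\<lambda>v. D (f v) + w * c (g v))"
proof -
  interpret H: pair_graph H by fact
  interpret G: pair_graph G by fact
  have inj: "inj_on D (pverts H)"
    and seg: "\<And>x y z. (x, y) \<in> parcs H \<Longrightarrow> z \<in> pverts H \<Longrightarrow>
      D z \<in> closed_segment (D x) (D y) \<Longrightarrow> z = x \<or> z = y"
    using assms(3) unfolding is_drawing_def by blast+
  have fH: "f v \<in> pverts H" if "v \<in> pverts G" for v
    using assms(4) that unfolding is_partition_def by blast
  have fE: "f v = f w \<or> (f v, f w) \<in> parcs H" if "(v, w) \<in> parcs G" for v w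
    using assms(4) that unfolding is_partition_def by blast
  \<comment> \<open>Once an element of \<open>A\<close> is multiplied by \<open>u\<close>, its
    imaginary part vanishes exactly when the turned chord from \<open>j\<close> to \<open>i\<close>
    is parallel to the edge \<open>xy\<close> of \<open>H\<close>.\<close>
  define A where "A = (\<lambda>((i, j), x, y). (c i - c j) * cnj (D y - D x)) `
    ({(i, j). i < k \<and> j < k \<and> i \<noteq> j} \<times> parcs H)"
  have "finite {(i, j). i < k \<and> j < k \<and> i \<noteq> j}"
    by (rule finite_subset[of _ "{..<k} \<times> {..<k}"]) auto
  then have finA: "finite A" unfolding A_def by (intro finite_imageI finite_cartesian_product) auto
  have 0: "0 \<notin> A"
  proof
    assume "0 \<in> A"
    then obtain i j x y where *: "i < k" "j < k" "i \<noteq> j" "(x, y) \<in> parcs H"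
      "(c i - c j) * cnj (D y - D x) = 0" unfolding A_def by auto
    have "x \<noteq> y" "x \<in> pverts H" "y \<in> pverts H"
      using *(4) H.no_loops' H.in_arcsD1 H.in_arcsD2 by blast+
    then have "D y \<noteq> D x" using inj by (metis inj_onD)
    moreover have "c i \<noteq> c j" using c(1) *(1-3) by (metis inj_onD lessThan_iff)
    ultimately show False using *(5) by simp
  qed
  obtain u where u: "u \<noteq> 0" "\<And>a. a \<in> A \<Longrightarrow> Im (u * a) \<noteq> 0"
    using exists_generic_rotation[OF finA 0] by blast
  have gen: "Im ((u * c i - u * c j) * cnj (D y - D x)) \<noteq> 0"
    if "i < k" "j < k" "i \<noteq> j" "(x, y) \<in> parcs H" for i j x y
  proof -
    have "(c i - c j) * cnj (D y - D x) \<in> A"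
      unfolding A_def by (rule image_eqI[of _ _ "((i, j), x, y)"]) (use that in auto)
    from u(2)[OF this] show ?thesis
      by (simp only: right_diff_distrib[symmetric] mult.assoc not_False_eq_True)
  qed
  define P where "P = (\<lambda>e::real. \<lambda>v. D (f v) + e *\<^sub>R (u * c (g v)))"
  \<comment> \<open>The segment is degenerate, so this separates two points by the perturbation
    lemma for segments.\<close>
  have far: "\<forall>\<^sub>F e in at_right 0. P e z \<notin> closed_segment (P e v) (P e v)"
    if "v \<in> pverts G" "z \<in> pverts G" "f z \<noteq> f v" for v z
    unfolding P_def using that fH inj
    by (intro eventually_notin_closed_segment) (auto dest: inj_onD)
  have near: "P e z \<noteq> P e v"
    if "v \<in> pverts G" "z \<in> pverts G" "f z = f v" "z \<noteq> v" "e > 0" for v z e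
  proof -
    have "g z \<noteq> g v" using g(2) that by blast
    then have "c (g z) \<noteq> c (g v)" using g(1) c(1) that by (metis inj_onD lessThan_iff)
    then show ?thesis using that u(1) by (simp add: P_def)
  qed
  have pos: "\<forall>\<^sub>F e in at_right (0::real). e > 0" by (rule eventually_at_right_less)
  have dist: "\<forall>\<^sub>F e in at_right 0. P e z \<noteq> P e v"
    if "v \<in> pverts G" "z \<in> pverts G" "z \<noteq> v" for v z
  proof (cases "f z = f v")
    case True
    show ?thesis using pos by eventually_elim (use near that True in blast)
  next
    case False
    show ?thesis using far[OF that(1,2) False] by eventually_elim auto
  qed
  have edge: "\<forall>\<^sub>F e in at_right 0. P e z \<notin> closed_segment (P e v) (P e w)"
    if vw: "(v, w) \<in> parcs G" and z: "z \<in> pverts G" "z \<noteq> v" "z \<noteq> w" for v w z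
  proof -
    have V: "v \<in> pverts G" "w \<in> pverts G" using vw G.in_arcsD1 G.in_arcsD2 by blast+
    \<comment> \<open>The cases record which of the three vertices share a part. Cases 3 and 4,
      where \<open>z\<close> lies in the part of one end of an edge between parts, are those that
      need the generic rotation.\<close>
    consider "f v = f w" "f z = f v" | "f v = f w" "f z \<noteq> f v"
      | "(f v, f w) \<in> parcs H" "f z = f v" | "(f v, f w) \<in> parcs H" "f z = f w"
      | "(f v, f w) \<in> parcs H" "f z \<noteq> f v" "f z \<noteq> f w" using fE[OF vw] by blast
    then show ?thesis
    proof cases
      case 1
      show ?thesis using pos
      proof eventually_elim
        case (elim e)
        show ?case
        proof
          assume "P e z \<in> closed_segment (P e v) (P e w)"
          \<comment> \<open>Translating by \<open>- D (f v)\<close> puts all three points on the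
            circle of radius \<open>e * norm u\<close> around 0.\<close>
          then have "e *\<^sub>R (u * c (g z)) \<in> closed_segment (e *\<^sub>R (u * c (g v))) (e *\<^sub>R (u * c (g w)))"
            using 1 by (simp add: P_def closed_segment_translation_eq)
          then have "e *\<^sub>R (u * c (g z)) = e *\<^sub>R (u * c (g v)) \<or> e *\<^sub>R (u * c (g z)) = e *\<^sub>R (u * c (g w))"
            by (rule closed_segment_circle_endpoint[where r = "e * norm u"])
              (use elim c(2) in \<open>simp_all add: norm_mult\<close>)
          then have "P e z = P e v \<or> P e z = P e w" using 1 by (auto simp: P_def)
          then show False using near V z 1 elim by metis
        qed
      qed
    next
      \<comment> \<open>In the limit the edge shrinks to the point \<open>D (f v)\<close>, which
        differs from \<open>D (f z)\<close>.\<close>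
      case 2
      then show ?thesis unfolding P_def using V z fH inj
        by (intro eventually_notin_closed_segment) (auto dest: inj_onD)
    next
      case 3
      then have "g z \<noteq> g v" using g(2) V z by blast
      with 3 show ?thesis
        unfolding P_def using eventually_notin_closed_segment_endpoint gen g(1) V z(1) by simp
    next
      case 4
      then have "g z \<noteq> g w" using g(2) V z by blast
      moreover have "(f w, f v) \<in> parcs H" using 4 H.arcs_symmetric by blast
      ultimately show ?thesis
        unfolding P_def closed_segment_commute[of "D (f v) + _"]
        using eventually_notin_closed_segment_endpoint gen g(1) V z(1) 4 by simp
    next
      case 5
      then have "D (f z) \<notin> closed_segment (D (f v)) (D (f w))" using seg fH z(1) by blast
      then show ?thesis unfolding P_def by (rule eventually_notin_closed_segment)
    qed
  qed
  \<comment> \<open>There are finitely many vertices and arcs, so one scale serves all conditions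
    together.\<close>
  have "\<forall>\<^sub>F e in at_right 0. \<forall>v \<in> pverts G. \<forall>z \<in> pverts G. z \<noteq> v \<longrightarrow> P e z \<noteq> P e v"
    using dist by (intro eventually_ball_finite ballI G.finite_verts) (auto simp: eventually_mono)
  moreover have "\<forall>\<^sub>F e in at_right 0. \<forall>a \<in> parcs G. \<forall>z \<in> pverts G.
      z \<noteq> fst a \<and> z \<noteq> snd a \<longrightarrow> P e z \<notin> closed_segment (P e (fst a)) (P e (snd a))"
  proof (intro eventually_ball_finite ballI G.finite_verts G.finite_arcs)
    fix a z assume "a \<in> parcs G" "z \<in> pverts G"
    then show "\<forall>\<^sub>F e in at_right 0. z \<noteq> fst a \<and> z \<noteq> snd a \<longrightarrow>
        P e z \<notin> closed_segment (P e (fst a)) (P e (snd a))"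
      using edge[of "fst a" "snd a" z] by (cases "z \<noteq> fst a \<and> z \<noteq> snd a") auto
  qed
  ultimately have "\<forall>\<^sub>F e in at_right 0. e > 0 \<and> is_drawing G (P e)"
    using pos
  proof eventually_elim
    case (elim e)
    then show ?case unfolding is_drawing_def inj_on_def by fastforce
  qed
  then obtain e where "e > 0" "is_drawing G (P e)"
    using eventually_happens' trivial_limit_at_right_real by blast
  then show thesis
    using that[of "of_real e * u"] u(1) unfolding P_def by (simp add: scaleR_conv_of_real mult.assoc)
qed

section \<open>Counting slopes and lengths\<close>

lemma edge_sets_as_images:
  "edge_slopes H D = (\<lambda>(u, v). slope (D u) (D v)) ` parcs H"
  "edge_lengths H D = (\<lambda>(u, v). dist (D u) (D v)) ` parcs H"
  "edge_slope_lengths H D = (\<lambda>(u, v). (slope (D u) (D v), dist (D u) (D v))) ` parcs H"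
proof -
  have *: "{F u v | u v. (u, v) \<in> A} = (\<lambda>(u, v). F u v) ` A" for F :: "'b \<Rightarrow> 'b \<Rightarrow> 'c" and A
    by force
  show "edge_slopes H D = (\<lambda>(u, v). slope (D u) (D v)) ` parcs H"
    unfolding edge_slopes_def by (rule *)
  show "edge_lengths H D = (\<lambda>(u, v). dist (D u) (D v)) ` parcs H"
    unfolding edge_lengths_def by (rule *)
  show "edge_slope_lengths H D = (\<lambda>(u, v). (slope (D u) (D v), dist (D u) (D v))) ` parcs H"
    unfolding edge_slope_lengths_def by (rule *)
qed

text \<open>The three sets stand for edges inside a part, edges between equal corners, and edges
  between different corners.\<close>

lemma card_Un3_image_le:
  assumes "E \<subseteq> F1 ` S1 \<union> S2 \<union> F3 ` S3" "finite S1" "finite S2" "finite S3"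
  shows "card E \<le> card S1 + card S2 + card S3"
proof -
  have "card E \<le> card (F1 ` S1 \<union> S2 \<union> F3 ` S3)" using assms by (intro card_mono) auto
  also have "\<dots> \<le> card (F1 ` S1) + card S2 + card (F3 ` S3)"
    by (meson add_le_mono1 card_Un_le order_trans)
  also have "\<dots> \<le> card S1 + card S2 + card S3" using assms by (intro add_mono card_image_le) auto
  finally show ?thesis .
qed

theorem theorem3:
  fixes H :: "'b pair_pre_digraph" and G :: "'a pair_pre_digraph"
    and D :: "'b \<Rightarrow> complex" and f :: "'a \<Rightarrow> 'b"
    and s l t k :: nat
  assumes "pair_graph H" and "pair_graph G"
    and "is_drawing H D"
    and "s = card (edge_slopes H D)"
    and "l = card (edge_lengths H D)"
    and "t = card (edge_slope_lengths H D)"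
    and "is_partition H G f"
    and "partition_width H G f = k"
  shows "t \<le> s * l \<and>
    (\<exists>D'. is_drawing G D' \<and>
       card (edge_slopes G D') \<le> k + s + t * (k\<^sup>2 - k) \<and>
       k + s + t * (k\<^sup>2 - k) \<le> k + s + s * l * (k\<^sup>2 - k) \<and>
       card (edge_lengths G D') \<le> k div 2 + l + t * (k\<^sup>2 - k) \<and>
       k div 2 + l + t * (k\<^sup>2 - k) \<le> k div 2 + l + s * l * (k\<^sup>2 - k))"
proof -
  interpret H: pair_graph H by fact
  interpret G: pair_graph G by fact
  have fin: "finite (edge_slopes H D)" "finite (edge_lengths H D)" "finite (edge_slope_lengths H D)"
    unfolding edge_sets_as_images by auto
  have "edge_slope_lengths H D \<subseteq> edge_slopes H D \<times> edge_lengths H D"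
    unfolding edge_sets_as_images by auto
  then have tsl: "t \<le> s * l"
    using card_mono[of "edge_slopes H D \<times> edge_lengths H D"] fin assms(4-6)
    by (simp add: card_cartesian_product)
  have fPi: "f \<in> pverts G \<rightarrow> pverts H" using assms(7) unfolding is_partition_def by blast
  obtain g where g: "\<And>v. v \<in> pverts G \<Longrightarrow> g v < k"
    "\<And>v w. v \<in> pverts G \<Longrightarrow> w \<in> pverts G \<Longrightarrow> f v = f w \<Longrightarrow> g v = g w \<Longrightarrow> v = w"
    using partition_index[OF H.finite_verts G.finite_verts fPi assms(8)] by blast
  define c where "c = polygon_corner k"
  obtain W where W: "W \<noteq> 0" "is_drawing G (\<lambda>v. D (f v) + W * c (g v))"
    unfolding c_def
    by (rule exists_blow_up_drawing[OF assms(1-3,7) g inj_on_polygon_corner norm_polygon_corner])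
  define D' where "D' = (\<lambda>v. D (f v) + W * c (g v))"
  have D'_inj: "inj_on D' (pverts G)" using W(2) unfolding D'_def is_drawing_def by blast
  define R where "R = {(i, j). i < k \<and> j < k \<and> i \<noteq> j}"
  have finR: "finite R" unfolding R_def by (rule finite_subset[of _ "{..<k} \<times> {..<k}"]) auto
  define T where "T = edge_slope_lengths H D \<times> R"
  have T: "finite T" "card T = t * (k\<^sup>2 - k)"
    using fin finR assms(6) card_off_diagonal[of k] by (auto simp: T_def R_def card_cartesian_product)
  \<comment> \<open>\<open>B\<close> gives the vector from corner \<open>i\<close> over one end of
    an edge of \<open>H\<close> to corner \<open>j\<close> over the other, the edge being oriented
    so that its vector is \<open>r\<close> times \<open>cis \<sigma>\<close>.\<close>
  define B :: "(real \<times> real) \<times> nat \<times> nat \<Rightarrow> complex"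
    where "B = (\<lambda>((\<sigma>, r), i, j). of_real r * cis \<sigma> + W * (c j - c i))"
  define inner_slope where
    "inner_slope = (\<lambda>m. slope 0 (W * (\<i> * cis (pi * real m / real k))))"
  define inner_length where
    "inner_length = (\<lambda>d. norm W * (2 * \<bar>sin (pi * real d / real k)\<bar>))"
  have edge: "slope (D' v) (D' w) \<in>
      inner_slope ` {..<k} \<union> edge_slopes H D \<union> (\<lambda>x. slope 0 (B x)) ` T \<and>
      dist (D' v) (D' w) \<in>
      inner_length ` {1..k div 2} \<union> edge_lengths H D \<union> (\<lambda>x. norm (B x)) ` T"
    if vw: "(v, w) \<in> parcs G" for v w
  proof -
    have V: "v \<in> pverts G" "w \<in> pverts G" "v \<noteq> w"
      using vw G.in_arcsD1 G.in_arcsD2 G.no_loops' by blast+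
    then have ne: "D' v \<noteq> D' w" using D'_inj by (metis inj_onD)
    have gk: "g v < k" "g w < k" using g(1) V by auto
    have dist: "dist (D' v) (D' w) = norm (D' w - D' v)" by (simp add: dist_norm norm_minus_commute)
    consider "f v = f w" | "(f v, f w) \<in> parcs H" "g v = g w"
      | "(f v, f w) \<in> parcs H" "g v \<noteq> g w"
      using assms(7) vw unfolding is_partition_def by blast
    then show ?thesis
    proof cases
      case 1
      then have gne: "g v \<noteq> g w" using g(2) V by blast
      have diff: "D' w - D' v = W * (polygon_corner k (g w) - polygon_corner k (g v))"
        using 1 by (simp add: D'_def c_def algebra_simps)
      have "slope (D' v) (D' w) = inner_slope ((g v + g w) mod k)"
        unfolding inner_slope_def by (rule polygon_corner_slope[OF gk W(1) diff ne])
      moreover have "dist (D' v) (D' w) = norm W * norm (polygon_corner k (g w) - polygon_corner k (g v))"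
        unfolding dist diff by (rule norm_mult)
      ultimately show ?thesis
        using polygon_corner_dist[OF gk gne] gk unfolding inner_length_def by auto
    next
      case 2
      \<comment> \<open>Equal corners cancel, so the edge is a translate of an edge of
        \<open>H\<close>.\<close>
      then have diff: "D' w - D' v = of_real 1 * (D (f w) - D (f v))" by (simp add: D'_def)
      then have "D (f v) \<noteq> D (f w)" using ne by auto
      then have "slope (D' v) (D' w) = slope (D (f v)) (D (f w))"
        using slope_scale[OF diff] by simp
      moreover have "dist (D' v) (D' w) = dist (D (f v)) (D (f w))"
        unfolding dist diff by (simp add: dist_norm norm_minus_commute)
      ultimately show ?thesis using 2 unfolding edge_slopes_def edge_lengths_def by blast
    next
      case 3
      define \<sigma> r where "\<sigma> = slope (D (f v)) (D (f w))" and "r = dist (D (f v)) (D (f w))"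
      have \<sigma>r: "(\<sigma>, r) \<in> edge_slope_lengths H D"
        using 3 unfolding edge_slope_lengths_def \<sigma>_def r_def by blast
      have "f v \<noteq> f w" "f v \<in> pverts H" "f w \<in> pverts H"
        using 3 H.no_loops' H.in_arcsD1 H.in_arcsD2 by blast+
      then have "D (f v) \<noteq> D (f w)" using assms(3) unfolding is_drawing_def by (metis inj_onD)
      then obtain d :: real where d: "D (f w) - D (f v) = of_real d * cis \<sigma>" "\<bar>d\<bar> = r"
        unfolding \<sigma>_def r_def by (rule slope_polar)
      have diff: "D' w - D' v = of_real d * cis \<sigma> + W * (c (g w) - c (g v))"
        using d(1) by (simp add: D'_def algebra_simps)
      \<comment> \<open>If \<open>d\<close> is negative, the edge is read backwards: the whole
        vector changes sign and the two corners swap. So a slope-length pair and an ordered pair of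
        corners suffice, with no further factor 2 for orientation.\<close>
      obtain x and a :: real where x: "x \<in> T" "D' w - D' v = of_real a * (B x - 0)" "\<bar>a\<bar> = 1"
      proof (cases "d \<ge> 0")
        case True
        then show ?thesis
          using that[of "((\<sigma>, r), g v, g w)" 1] \<sigma>r 3 gk diff d(2) by (auto simp: T_def R_def B_def)
      next
        case False
        then have "d = - r" using d(2) by auto
        then show ?thesis
          using that[of "((\<sigma>, r), g w, g v)" "-1"] \<sigma>r 3 gk diff
          by (auto simp: T_def R_def B_def algebra_simps)
      qed
      \<comment> \<open>\<open>B\<close> may vanish elsewhere on \<open>T\<close>, but not at an
        \<open>x\<close> that comes from an edge, whose ends are distinct.\<close>
      have "B x \<noteq> 0" "a \<noteq> 0" using x ne by auto
      then have "slope (D' v) (D' w) = slope 0 (B x)" using slope_scale[OF x(2)] by simp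
      moreover have "dist (D' v) (D' w) = norm (B x)"
        unfolding dist x(2) using x(3) by (simp add: norm_mult)
      ultimately show ?thesis using x(1) by blast
    qed
  qed
  have "edge_slopes G D' \<subseteq> inner_slope ` {..<k} \<union> edge_slopes H D \<union> (\<lambda>x. slope 0 (B x)) ` T"
    using edge unfolding edge_slopes_def by blast
  from card_Un3_image_le[OF this] have slopes: "card (edge_slopes G D') \<le> k + s + t * (k\<^sup>2 - k)"
    using T fin assms(4) by simp
  have "edge_lengths G D' \<subseteq> inner_length ` {1..k div 2} \<union> edge_lengths H D \<union> (\<lambda>x. norm (B x)) ` T"
    using edge unfolding edge_lengths_def by blast
  from card_Un3_image_le[OF this] have lengths: "card (edge_lengths G D') \<le> k div 2 + l + t * (k\<^sup>2 - k)"
    using T fin assms(5) by simp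
  show ?thesis
    using tsl slopes lengths W(2) unfolding D'_def[symmetric] by (auto intro!: exI[of _ D'] mult_le_mono1)
qed

end
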